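(* Let $M$ be a partial TP matrix and $U$ a set of unspecified positions of $M$ for which no assignment of real values to the positions of $U$ yields a partial TP matrix. If an inhibiting set for $(M,U)$ consists only of convex $U$-atoms, then it contains at most $|U|+1$ atoms.
   Context: A partial matrix is a rectangular array some of whose entries are real numbers (specified) and others unspecified; it is partial TP if every square submatrix (rows and columns arbitrary, not necessarily contiguous) consisting only of specified entries has positive determinant. Write $\mathbf{u}\in\mathbb{R}^{|U|}$ for the variables at the positions of $U$, and for a square submatrix $S$ whose unspecified entries lie in $U$ let $\det S(\mathbf{u})$ be its determinant as a function of $\mathbf{u}$. A $U$-atom is a square submatrix $S$ with row set $R$ and column set $C$ such that: (a) every unspecified entry of $S$ lies in $U$, and $S$ contains at least one unspecified entry; (b) for each column $c\notin C$ with $\min C<c<\max C$, some position $(r,c)$ with $r\in R$ is unspecified and not in $U$; (c) for each row $r\notin R$ with $\min R<r<\max R$, some position $(r,c)$ with $c\in C$ is unspecified and not in $U$. An inhibiting set for $(M,U)$ is a set $A$ of $U$-atoms of smallest possible size such that the system $\{\det S(\mathbf{u})>0 \mid S\in A\}$ has no solution. A $U$-atom $S$ is convex if $\{\mathbf{u}\in\mathbb{R}^{|U|}:\det S(\mathbf{u})>0\}$ is a convex set. *)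

theory Defs
  imports
    "HOL-Analysis.Convex"
    "HOL-Analysis.Finite_Function_Topology"
    "Jordan_Normal_Form.Determinant"
    "Jordan_Normal_Form.DL_Submatrix"
begin

text \<open>A partial matrix: \<^term>\<open>None\<close> marks an unspecified entry. Rows and columns are
  indexed from 0.\<close>

type_synonym partial_mat = "real option mat"

definition unspecified :: "partial_mat \<Rightarrow> (nat \<times> nat) set" where
  "unspecified M = {(r, c). r < dim_row M \<and> c < dim_col M \<and> M $$ (r, c) = None}"

text \<open>A square submatrix is represented by its row set and its column set.\<close>

definition square_submatrix :: "partial_mat \<Rightarrow> nat set \<Rightarrow> nat set \<Rightarrow> bool" where
  "square_submatrix M R C \<longleftrightarrow> R \<subseteq> {..<dim_row M} \<and> C \<subseteq> {..<dim_col M} \<and> card R = card C"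

text \<open>Meaningful only if all entries in rows \<open>R\<close> and columns \<open>C\<close> are specified; it is only
  used in that case.\<close>

definition minor :: "partial_mat \<Rightarrow> nat set \<Rightarrow> nat set \<Rightarrow> real" where
  "minor M R C = det (submatrix (map_mat the M) R C)"

text \<open>The empty submatrix is admitted here, but its determinant is 1.\<close>

definition partial_TP :: "partial_mat \<Rightarrow> bool" where
  "partial_TP M \<longleftrightarrow>
     (\<forall>R C. square_submatrix M R C \<longrightarrow> (R \<times> C) \<inter> unspecified M = {} \<longrightarrow> minor M R C > 0)"

text \<open>The space of real vectors indexed by the finite set \<open>U\<close>, as the coordinate subspace of the
  real vector space of finitely supported functions, so that \<^const>\<open>convex\<close> applies.\<close>

definition coord_space :: "(nat \<times> nat) set \<Rightarrow> ((nat \<times> nat) \<Rightarrow>\<^sub>0 real) set" where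
  "coord_space U = {u. Poly_Mapping.keys u \<subseteq> U}"

definition assign ::
    "partial_mat \<Rightarrow> (nat \<times> nat) set \<Rightarrow> ((nat \<times> nat) \<Rightarrow>\<^sub>0 real) \<Rightarrow> partial_mat" where
  "assign M U u = mat (dim_row M) (dim_col M)
     (\<lambda>p. if p \<in> U then Some (Poly_Mapping.lookup u p) else M $$ p)"

definition U_atom :: "partial_mat \<Rightarrow> (nat \<times> nat) set \<Rightarrow> nat set \<times> nat set \<Rightarrow> bool" where
  "U_atom M U = (\<lambda>(R, C).
     square_submatrix M R C \<and>
     (R \<times> C) \<inter> unspecified M \<subseteq> U \<and> (R \<times> C) \<inter> unspecified M \<noteq> {} \<and>
     (\<forall>c. c \<notin> C \<and> Min C < c \<and> c < Max C \<longrightarrow> (\<exists>r\<in>R. (r, c) \<in> unspecified M - U)) \<and>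
     (\<forall>r. r \<notin> R \<and> Min R < r \<and> r < Max R \<longrightarrow> (\<exists>c\<in>C. (r, c) \<in> unspecified M - U)))"

text \<open>The solution set of the inequality \<open>det S(u) > 0\<close>.\<close>

definition pos_set ::
    "partial_mat \<Rightarrow> (nat \<times> nat) set \<Rightarrow> nat set \<times> nat set \<Rightarrow> ((nat \<times> nat) \<Rightarrow>\<^sub>0 real) set" where
  "pos_set M U = (\<lambda>(R, C). {u \<in> coord_space U. minor (assign M U u) R C > 0})"

definition solvable :: "partial_mat \<Rightarrow> (nat \<times> nat) set \<Rightarrow> (nat set \<times> nat set) set \<Rightarrow> bool" where
  "solvable M U A \<longleftrightarrow> (\<exists>u\<in>coord_space U. \<forall>S\<in>A. u \<in> pos_set M U S)"

definition inhibiting_set ::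
    "partial_mat \<Rightarrow> (nat \<times> nat) set \<Rightarrow> (nat set \<times> nat set) set \<Rightarrow> bool" where
  "inhibiting_set M U A \<longleftrightarrow>
     A \<subseteq> Collect (U_atom M U) \<and> \<not> solvable M U A \<and>
     (\<forall>B. B \<subseteq> Collect (U_atom M U) \<and> \<not> solvable M U B \<longrightarrow> card A \<le> card B)"

definition convex_atom :: "partial_mat \<Rightarrow> (nat \<times> nat) set \<Rightarrow> nat set \<times> nat set \<Rightarrow> bool" where
  "convex_atom M U S \<longleftrightarrow> U_atom M U S \<and> convex (pos_set M U S)"

end

theory Submission
  imports Defs
begin

text \<open>Every subfamily of an inhibiting set \<open>A\<close> obtained by removing one atom is solvable, by
  minimality. If \<open>A\<close> had at least \<open>card U + 2\<close> atoms, the solutions obtained by removing each atom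
  in turn would be affinely dependent in the \<open>card U\<close>-dimensional space \<^term>\<open>coord_space U\<close>; the
  Radon point of these solutions would lie in all the convex solution sets (Helly), so that \<open>A\<close>
  would be solvable.\<close>

text \<open>Subtracting one point from the others leaves \<open>card I - 1 > card B\<close> vectors
  in \<open>span B\<close>, too many to be independent. Working with an indexed family covers
  coinciding points, which a set of points would merge.\<close>

lemma affine_dependence_of_family:
  fixes x :: "'i \<Rightarrow> 'a::real_vector"
  assumes "finite I" "finite B" "card B + 2 \<le> card I" "x ` I \<subseteq> span B"
  obtains c where "sum c I = 0" "(\<Sum>i\<in>I. c i *\<^sub>R x i) = 0" "\<exists>i\<in>I. c i \<noteq> 0"
proof (cases "inj_on x I")
  case False
  then obtain i j where ij: "i \<in> I" "j \<in> I" "i \<noteq> j" "x i = x j"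
    by (auto simp: inj_on_def)
  \<comment> \<open>Coinciding points cancel each other with weights 1 and -1.\<close>
  define c where "c k = (if k = i then 1 else 0) - (if k = j then 1 else (0::real))" for k
  have "sum c I = 0"
    using assms(1) ij by (simp add: c_def sum_subtractf)
  moreover have "(\<Sum>k\<in>I. c k *\<^sub>R x k) = 0"
    using assms(1) ij
    by (simp add: c_def scaleR_left_diff_distrib sum_subtractf if_distrib[of "\<lambda>t. t *\<^sub>R _"] cong: if_cong)
  moreover have "c i \<noteq> 0"
    using ij by (simp add: c_def)
  ultimately show thesis
    using that ij(1) by blast
next
  case True
  obtain i where i: "i \<in> I"
    using assms(1,3) by fastforce
  let ?D = "(\<lambda>y. - x i + y) ` (x ` I - {x i})"
  have card: "card ?D = card I - 1"
    using True i assms(1) by (simp add: card_image card_Diff_singleton)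
  have "?D \<subseteq> span B"
    using assms(4) i by (auto intro!: span_add span_diff simp: image_subset_iff)
  then have "dependent ?D"
    using independent_span_bound[OF assms(2), of ?D] card assms(3) by linarith
  then have "affine_dependent (x ` I)"
    using affine_dependent_iff_dependent2[of "x i" "x ` I"] i by blast
  then obtain u where u: "sum u (x ` I) = 0" "\<exists>v\<in>x ` I. u v \<noteq> 0" "(\<Sum>v\<in>x ` I. u v *\<^sub>R v) = 0"
    using affine_dependent_explicit_finite[of "x ` I"] assms(1) by auto
  show thesis
    by (rule that[of "u \<circ> x"]) (use u True in \<open>auto simp: sum.reindex\<close>)
qed

text \<open>Separating the dependence by the sign of \<open>c\<close> and normalising writes one
  point as a convex combination over \<open>P\<close> and also over \<open>N\<close>. For
  \<open>j\<close> in either half, the combination over the other half uses only points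
  \<open>x i\<close> with \<open>i \<noteq> j\<close>, all in \<open>X j\<close>.\<close>

lemma Radon_point_in_Inter:
  fixes X :: "'i \<Rightarrow> 'a::real_vector set"
  assumes "finite I" and convex: "\<And>i. i \<in> I \<Longrightarrow> convex (X i)"
    and x: "\<And>i j. i \<in> I \<Longrightarrow> j \<in> I \<Longrightarrow> i \<noteq> j \<Longrightarrow> x i \<in> X j"
    and c: "sum c I = 0" "(\<Sum>i\<in>I. c i *\<^sub>R x i) = 0" "\<exists>i\<in>I. c i \<noteq> 0"
  shows "\<exists>p. \<forall>j\<in>I. p \<in> X j"
proof -
  define P where "P = {i\<in>I. 0 < c i}"
  \<comment> \<open>Zero coefficients go to \<open>N\<close>, so that the two halves cover
    \<open>I\<close>; they get weight 0.\<close>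
  define N where "N = {i\<in>I. c i \<le> 0}"
  have I: "I = P \<union> N" "P \<inter> N = {}" and fin: "finite P" "finite N"
    using assms(1) by (auto simp: P_def N_def)
  define s where "s = sum c P"
  have sN: "s = (\<Sum>i\<in>N. - c i)"
    using c(1) unfolding s_def I(1) sum.union_disjoint[OF fin I(2)] by (simp add: sum_negf)
  \<comment> \<open>A zero total would force every coefficient on both halves to vanish, all terms
    having the same sign.\<close>
  have "s \<noteq> 0"
  proof
    assume "s = 0"
    then have "\<forall>i\<in>P. c i = 0" "\<forall>i\<in>N. - c i = 0"
      using fin sum_nonneg_eq_0_iff[of P c] sum_nonneg_eq_0_iff[of N "\<lambda>i. - c i"] sN s_def
      by (auto simp: P_def N_def)
    then show False
      using c(3) I(1) by auto
  qed
  moreover have "s \<ge> 0"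
    unfolding s_def by (rule sum_nonneg) (simp add: P_def)
  ultimately have s: "s > 0" by simp
  define p where "p = (\<Sum>i\<in>P. (c i / s) *\<^sub>R x i)"
  have "p = (1 / s) *\<^sub>R (\<Sum>i\<in>P. c i *\<^sub>R x i)"
    by (simp add: p_def scaleR_sum_right)
  also have "(\<Sum>i\<in>P. c i *\<^sub>R x i) = (\<Sum>i\<in>N. (- c i) *\<^sub>R x i)"
    using c(2) unfolding I(1) sum.union_disjoint[OF fin I(2)]
    by (simp add: sum_negf eq_neg_iff_add_eq_0)
  finally have pN: "p = (\<Sum>i\<in>N. (- c i / s) *\<^sub>R x i)"
    by (simp add: scaleR_sum_right)
  have "p \<in> X j" if j: "j \<in> I" for j
  proof (cases "j \<in> N")
    case True
    show ?thesis unfolding p_def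
    proof (rule convex_sum[OF fin(1) convex[OF j]])
      show "(\<Sum>i\<in>P. c i / s) = 1"
        using s by (simp add: s_def flip: sum_divide_distrib)
      show "0 \<le> c i / s" if "i \<in> P" for i
        using s that by (simp add: P_def)
      show "x i \<in> X j" if "i \<in> P" for i
        using x[of i j] that True I j by blast
    qed
  next
    case False
    show ?thesis unfolding pN
    proof (rule convex_sum[OF fin(2) convex[OF j]])
      show "(\<Sum>i\<in>N. - c i / s) = 1"
        using s by (simp only: sN[symmetric] flip: sum_divide_distrib) simp
      show "0 \<le> - c i / s" if "i \<in> N" for i
        using s that by (simp add: N_def divide_nonpos_pos)
      show "x i \<in> X j" if "i \<in> N" for i
        using x[of i j] that False I j by blast
    qed
  qed
  then show ?thesis by blast
qed

text \<open>The critical case of Helly's theorem: the points \<open>x i\<close>, each lying in all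
  sets but possibly \<open>X i\<close>, are affinely dependent by their number, and their Radon
  point is common to all the sets.\<close>

lemma Helly_critical_family:
  fixes X :: "'i \<Rightarrow> 'a::real_vector set"
  assumes "finite I" "finite B" "card B + 2 \<le> card I"
    and "\<And>i. i \<in> I \<Longrightarrow> convex (X i)" "\<And>i. i \<in> I \<Longrightarrow> X i \<subseteq> span B"
    and "\<And>i. i \<in> I \<Longrightarrow> \<exists>p. \<forall>j\<in>I - {i}. p \<in> X j"
  shows "\<exists>p. \<forall>j\<in>I. p \<in> X j"
proof -
  obtain x where x: "\<And>i j. i \<in> I \<Longrightarrow> j \<in> I - {i} \<Longrightarrow> x i \<in> X j"
    using assms(6) by metis
  have "x i \<in> span B" if "i \<in> I" for i
  proof -
    \<comment> \<open>\<open>x i\<close> may lie outside \<open>X i\<close>, so its membership in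
      the span comes from another set of the family.\<close>
    have "card (I - {i}) > 0"
      using assms(3) that by simp
    then obtain j where "j \<in> I - {i}"
      by (metis card_gt_0_iff ex_in_conv)
    then show ?thesis
      using x assms(5) that by blast
  qed
  then obtain c where "sum c I = 0" "(\<Sum>i\<in>I. c i *\<^sub>R x i) = 0" "\<exists>i\<in>I. c i \<noteq> 0"
    using affine_dependence_of_family[OF assms(1-3), of x] by blast
  then show ?thesis
    using Radon_point_in_Inter[of I X x c] assms(1,4) x by auto
qed

lemma lookup_scaleR:
  fixes u :: "'b \<Rightarrow>\<^sub>0 'a::real_vector"
  shows "Poly_Mapping.lookup (a *\<^sub>R u) p = a *\<^sub>R Poly_Mapping.lookup u p"
proof -
  have "finite {i. a *\<^sub>R Poly_Mapping.lookup u i \<noteq> 0}"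
    by (rule finite_subset[OF _ finite_keys[of u]]) (auto simp: in_keys_iff)
  then show ?thesis
    by (simp add: scaleR_poly_mapping_def)
qed

text \<open>The unit vectors at the positions of \<open>U\<close> bound the dimension by
  \<open>card U\<close>.\<close>

lemma coord_space_subset_span:
  assumes "finite U"
  shows "coord_space U \<subseteq> span ((\<lambda>p. Poly_Mapping.single p 1) ` U)"
proof
  fix u assume "u \<in> coord_space U"
  then have u: "Poly_Mapping.keys u \<subseteq> U"
    by (simp add: coord_space_def)
  have "u = (\<Sum>p\<in>U. Poly_Mapping.lookup u p *\<^sub>R Poly_Mapping.single p 1)"
  proof (rule poly_mapping_eqI)
    fix q
    have "Poly_Mapping.lookup u q = (if q \<in> U then Poly_Mapping.lookup u q else 0)"
      using u by (auto simp: in_keys_iff)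
    then show "Poly_Mapping.lookup u q =
        Poly_Mapping.lookup (\<Sum>p\<in>U. Poly_Mapping.lookup u p *\<^sub>R Poly_Mapping.single p 1) q"
      using assms
      by (simp add: lookup_sum lookup_scaleR lookup_single when_def if_distrib cong: if_cong)
  qed
  also have "\<dots> \<in> span ((\<lambda>p. Poly_Mapping.single p 1) ` U)"
    by (intro span_sum span_scale span_base) auto
  finally show "u \<in> span ((\<lambda>p. Poly_Mapping.single p 1) ` U)" .
qed

lemma finite_unspecified: "finite (unspecified M)"
  by (rule finite_subset[of _ "{..<dim_row M} \<times> {..<dim_col M}"]) (auto simp: unspecified_def)

lemma finite_U_atoms: "finite (Collect (U_atom M U))"
  by (rule finite_subset[of _ "Pow {..<dim_row M} \<times> Pow {..<dim_col M}"])
    (auto simp: U_atom_def square_submatrix_def)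

text \<open>Minimality refers to \<open>card\<close>, so finiteness of \<open>A\<close> is what
  makes the removal of \<open>S\<close> a strict decrease.\<close>

lemma inhibiting_set_remove_solvable:
  assumes "inhibiting_set M U A" "S \<in> A"
  shows "solvable M U (A - {S})"
proof (rule ccontr)
  have A: "A \<subseteq> Collect (U_atom M U)"
    using assms(1) by (simp add: inhibiting_set_def)
  assume "\<not> solvable M U (A - {S})"
  then have "card A \<le> card (A - {S})"
    using assms(1) A unfolding inhibiting_set_def by blast
  then show False
    using assms(2) finite_subset[OF A finite_U_atoms] card_Diff1_less by fastforce
qed

theorem theorem9:
  fixes M :: partial_mat and U :: "(nat \<times> nat) set" and A :: "(nat set \<times> nat set) set"
  assumes "partial_TP M"
    and "U \<subseteq> unspecified M"
    and "\<not> (\<exists>u\<in>coord_space U. partial_TP (assign M U u))"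
    and "inhibiting_set M U A"
    and "\<forall>S\<in>A. convex_atom M U S"
  shows "card A \<le> card U + 1"
proof (rule ccontr)
  assume contra: "\<not> card A \<le> card U + 1"
  let ?B = "(\<lambda>p. Poly_Mapping.single p 1 :: (nat \<times> nat) \<Rightarrow>\<^sub>0 real) ` U"
  have finU: "finite U"
    using assms(2) finite_unspecified finite_subset by blast
  have A: "A \<subseteq> Collect (U_atom M U)" "\<not> solvable M U A"
    using assms(4) by (auto simp: inhibiting_set_def)
  have coord: "pos_set M U S \<subseteq> coord_space U" for S
    by (auto simp: pos_set_def)
  have "\<exists>p. \<forall>S\<in>A. p \<in> pos_set M U S"
  proof (rule Helly_critical_family[of A ?B])
    show "finite A"
      using finite_subset[OF A(1) finite_U_atoms] .
    show "card ?B + 2 \<le> card A"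
      using contra card_image_le[OF finU, of "\<lambda>p. Poly_Mapping.single p 1 :: _ \<Rightarrow>\<^sub>0 real"] by linarith
    show "pos_set M U S \<subseteq> span ?B" for S
      using coord coord_space_subset_span[OF finU] by blast
    show "\<exists>p. \<forall>T\<in>A - {S}. p \<in> pos_set M U T" if "S \<in> A" for S
      using inhibiting_set_remove_solvable[OF assms(4) that] unfolding solvable_def by blast
  qed (use finU assms(5) in \<open>auto simp: convex_atom_def\<close>)
  \<comment> \<open>Some atom must exist for the common point to be known to lie in
    \<open>coord_space U\<close>.\<close>
  moreover have "A \<noteq> {}"
    using contra by auto
  ultimately have "solvable M U A"
    using coord unfolding solvable_def by blast
  then show False
    using A(2) by blast
qed

end
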